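(* Suppose that $0<\lambda\le\sqrt2-1$ and $H\in\mathcal{U}_2(\lambda)$. Let $F=H+\overline{G}$ be a harmonic mapping in $\mathbb{D}$, where $G$ is analytic in $\mathbb{D}$ with $G(0)=0$, and whose dilatation $\omega(z)=\frac{G'(z)}{H'(z)}$ satisfies $\omega(0)=0$ and $$|\omega(z)|\le\frac{1-2\lambda-\lambda^2}{(1+\lambda)^2}\qquad\text{for all } z\in\mathbb{D}.$$ Then $F$ is sense-preserving and close-to-convex (univalent) in $\mathbb{D}$.
   Context: $\mathbb{D}=\{z\in\mathbb{C}:|z|<1\}$. $\mathcal{A}$ is the family of analytic functions $f$ in $\mathbb{D}$ with $f(0)=0=f'(0)-1$. For $0<\lambda\le1$, $\mathcal{U}(\lambda)$ is the set of $f\in\mathcal{A}$ with $\left|\left(\frac{z}{f(z)}\right)^2f'(z)-1\right|<\lambda$ for all $z\in\mathbb{D}$ (in particular $f$ does not vanish in $\mathbb{D}\setminus\{0\}$, and $z/f(z)$ is understood to be $1$ at $z=0$). $\mathcal{U}_2(\lambda)=\{f\in\mathcal{U}(\lambda): f''(0)=0\}$; functions in $\mathcal{U}(\lambda)$ are univalent, so $H'\ne0$ in $\mathbb{D}$. A harmonic mapping $F=H+\overline{G}$ ($H,G$ analytic) is sense-preserving if its Jacobian $J_F=|H'|^2-|G'|^2$ is positive in $\mathbb{D}$. A harmonic mapping $F$ is close-to-convex in $\mathbb{D}$ if it is univalent (injective) in $\mathbb{D}$ and the complement $D=\mathbb{C}\setminus F(\mathbb{D})$ can be filled with non-intersecting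 half-lines emanating on the boundary $\partial D$ and lying completely in $D$. *)

theory Defs
  imports "HOL-Complex_Analysis.Complex_Analysis"
begin

abbreviation unit_disc :: "complex set" where
  "unit_disc \<equiv> ball 0 1"

definition class_A :: "(complex \<Rightarrow> complex) set" where
  "class_A = {f. f holomorphic_on unit_disc \<and> f 0 = 0 \<and> deriv f 0 = 1}"

text \<open>
  The value of \<open>z / f z\<close> at the removable singularity 0 is 1, the limit for \<open>f\<close> in
  \<open>class_A\<close>; HOL's \<open>0 / 0 = 0\<close> would be wrong there.
\<close>
definition z_over :: "(complex \<Rightarrow> complex) \<Rightarrow> complex \<Rightarrow> complex" where
  "z_over f z = (if z = 0 then 1 else z / f z)"

text \<open>
  The non-vanishing condition says that the quotient is defined. For \<open>lam \<le> 1\<close> it already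
  follows from the inequality, since \<open>z / 0 = 0\<close> in HOL.
\<close>
definition class_U :: "real \<Rightarrow> (complex \<Rightarrow> complex) set" where
  "class_U lam = {f \<in> class_A. (\<forall>z\<in>unit_disc - {0}. f z \<noteq> 0) \<and>
     (\<forall>z\<in>unit_disc. cmod ((z_over f z)\<^sup>2 * deriv f z - 1) < lam)}"

definition class_U2 :: "real \<Rightarrow> (complex \<Rightarrow> complex) set" where
  "class_U2 lam = {f \<in> class_U lam. (deriv ^^ 2) f 0 = 0}"

definition harmonic_mapping ::
  "(complex \<Rightarrow> complex) \<Rightarrow> (complex \<Rightarrow> complex) \<Rightarrow> (complex \<Rightarrow> complex) \<Rightarrow> bool" where
  "harmonic_mapping F H G \<longleftrightarrow> H holomorphic_on unit_disc \<and> G holomorphic_on unit_disc \<and>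
     (\<forall>z\<in>unit_disc. F z = H z + cnj (G z))"

definition dilatation :: "(complex \<Rightarrow> complex) \<Rightarrow> (complex \<Rightarrow> complex) \<Rightarrow> complex \<Rightarrow> complex" where
  "dilatation H G z = deriv G z / deriv H z"

text \<open>The Jacobian determinant of \<open>H + cnj \<circ> G\<close> in terms of its analytic parts.\<close>
definition jacobian :: "(complex \<Rightarrow> complex) \<Rightarrow> (complex \<Rightarrow> complex) \<Rightarrow> complex \<Rightarrow> real" where
  "jacobian H G z = (cmod (deriv H z))\<^sup>2 - (cmod (deriv G z))\<^sup>2"

definition sense_preserving :: "(complex \<Rightarrow> complex) \<Rightarrow> (complex \<Rightarrow> complex) \<Rightarrow> bool" where
  "sense_preserving H G \<longleftrightarrow> (\<forall>z\<in>unit_disc. jacobian H G z > 0)"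

definition half_line :: "complex \<Rightarrow> complex \<Rightarrow> complex set" where
  "half_line a u = {a + of_real t * u | t. t \<ge> 0}"

text \<open>
  Half-lines contain their end points, and non-intersecting means pairwise disjoint, end points
  included. The family may be empty, when the complement is.
\<close>
definition filled_by_half_lines :: "complex set \<Rightarrow> bool" where
  "filled_by_half_lines D \<longleftrightarrow>
     (\<exists>\<R>. (\<forall>L\<in>\<R>. (\<exists>a u. a \<in> frontier D \<and> u \<noteq> 0 \<and> L = half_line a u) \<and> L \<subseteq> D) \<and>
          pairwise disjnt \<R> \<and> \<Union>\<R> = D)"

definition close_to_convex :: "(complex \<Rightarrow> complex) \<Rightarrow> bool" where
  "close_to_convex F \<longleftrightarrow>
     inj_on F unit_disc \<and> filled_by_half_lines (- (F ` unit_disc))"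

end

theory Submission
  imports Defs
begin

text \<open>
  The derivative of \<open>H \<in> \<U>\<^sub>2(\<lambda>)\<close> is \<open>(1 + g) / p\<^sup>2\<close> with \<open>|g| \<le> \<lambda>\<close> and \<open>|p - 1| \<le> \<lambda>\<close>, so the bound on
  the dilatation gives \<open>Re H' - |G'| \<ge> c > 0\<close> on the disc. Hence \<open>F\<close> is Lipschitz and strongly
  monotone, extends to the closed disc with both properties, and the rays \<open>F a + t a\<close>
  with \<open>|a| = 1\<close>, \<open>t \<ge> 0\<close> fill the complement of the image.
\<close>

section \<open>Bounds for \<open>z / H z\<close> and the derivative of \<open>H\<close>\<close>

text \<open>On a circle of radius \<open>r < 1\<close>, division by \<open>z ^ n\<close> costs a
  factor \<open>1 / r ^ n\<close>; the maximum principle carries the bound inward, and the factor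
  tends to 1 as \<open>r\<close> does.\<close>

lemma norm_le_of_norm_power_mult_le:
  fixes f :: "complex \<Rightarrow> complex"
  assumes f: "f holomorphic_on ball 0 1"
    and le: "\<And>z. z \<in> ball 0 1 \<Longrightarrow> cmod (z ^ n * f z) \<le> B"
    and z: "z \<in> ball 0 1"
  shows "cmod (f z) \<le> B"
proof -
  have *: "r ^ n * cmod (f z) \<le> B" if r: "cmod z < r" "r < 1" for r
  proof -
    have r0: "0 < r" using r norm_ge_zero[of z] by linarith
    have "cmod (f z) \<le> B / r ^ n"
    proof (rule maximum_modulus_frontier[of f "cball 0 r"])
      show "f holomorphic_on interior (cball 0 r)"
        by (rule holomorphic_on_subset[OF f]) (use r in auto)
      show "continuous_on (closure (cball 0 r)) f"
        by (rule continuous_on_subset[OF holomorphic_on_imp_continuous_on[OF f]]) (use r in auto)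
      fix w assume "w \<in> frontier (cball 0 r :: complex set)"
      then have w: "cmod w = r" using r0 by (simp add: frontier_cball)
      then have "r ^ n * cmod (f w) \<le> B"
        using le[of w] r by (simp add: norm_mult norm_power)
      then show "cmod (f w) \<le> B / r ^ n"
        using r0 by (simp add: field_simps)
    qed (use r in auto)
    then show ?thesis using r0 by (simp add: field_simps)
  qed
  have "((\<lambda>r. r ^ n * cmod (f z)) \<longlongrightarrow> 1 ^ n * cmod (f z)) (at_left 1)"
    by (intro tendsto_intros)
  moreover have "\<forall>\<^sub>F r in at_left (1::real). r ^ n * cmod (f z) \<le> B"
    using eventually_at_left_real[of "cmod z" 1] z
    by (auto elim!: eventually_mono intro!: *)
  ultimately show ?thesis
    using tendsto_upperbound by fastforce
qed

text \<open>
  With \<open>z / H z = 1 + z u z\<close> one has \<open>(z / H z)\<^sup>2 H' z - 1 = - z\<^sup>2 u' z\<close>, and \<open>u 0 = 0\<close> because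
  \<open>H'' 0 = 0\<close>. The maximum principle bounds \<open>u'\<close>, and integration bounds \<open>u\<close>.
\<close>
lemma class_U2_z_over_bound:
  assumes H: "H \<in> class_U2 lam" and z: "z \<in> unit_disc"
  shows "cmod (z_over H z - 1) \<le> lam"
proof -
  have hol: "H holomorphic_on unit_disc" and H0: "H 0 = 0" and dH0: "deriv H 0 = 1"
    and nz: "\<And>z. z \<in> unit_disc \<Longrightarrow> z \<noteq> 0 \<Longrightarrow> H z \<noteq> 0"
    and U: "\<And>z. z \<in> unit_disc \<Longrightarrow> cmod ((z_over H z)\<^sup>2 * deriv H z - 1) < lam"
    and H2: "deriv (deriv H) 0 = 0"
    using H by (auto simp: class_U2_def class_U_def class_A_def numeral_2_eq_2)
  \<comment> \<open>\<open>q\<close> is \<open>H z / z\<close> with its singularity removed. It has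
    no zeros, so its reciprocal \<open>p\<close> below is a holomorphic form of
    \<open>z_over H\<close>.\<close>
  define q where "q z = (if z = 0 then deriv H 0 else (H z - H 0) / (z - 0))" for z
  have q_hol: "q holomorphic_on unit_disc"
    unfolding q_def using pole_lemma[OF hol, of 0] by simp
  have q_nz: "q z \<noteq> 0" if "z \<in> unit_disc" for z
    using that nz[of z] by (auto simp: q_def H0 dH0)
  have Hq: "H z = z * q z" for z by (simp add: q_def H0)
  have q0: "q 0 = 1" by (simp add: q_def dH0)
  have dq: "(q has_field_derivative deriv q z) (at z)" if "z \<in> unit_disc" for z
    using q_hol that holomorphic_derivI[of q unit_disc z] by auto
  have dH: "deriv H z = q z + z * deriv q z" if "z \<in> unit_disc" for z
  proof (rule DERIV_imp_deriv)
    have "((\<lambda>z. z * q z) has_field_derivative q z + z * deriv q z) (at z)"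
      by (auto intro!: derivative_eq_intros dq[OF that])
    then show "(H has_field_derivative q z + z * deriv q z) (at z)"
      using Hq by presburger
  qed
  \<comment> \<open>Differentiating \<open>H' = q + z q'\<close> at 0 gives
    \<open>H'' = 2 q'\<close> there; this is where the normalisation of the second derivative
    enters.\<close>
  have dq0: "deriv q 0 = 0"
  proof -
    have "(deriv q has_field_derivative deriv (deriv q) 0) (at 0)"
      using holomorphic_derivI[OF holomorphic_deriv[OF q_hol], of 0] by simp
    then have "((\<lambda>z. q z + z * deriv q z) has_field_derivative 2 * deriv q 0) (at 0)"
      by (auto intro!: derivative_eq_intros dq)
    then have "(deriv H has_field_derivative 2 * deriv q 0) (at 0)"
      by (rule has_field_derivative_transform_within_open[of _ _ _ unit_disc])
         (auto simp: dH)
    then show ?thesis using H2 DERIV_imp_deriv by fastforce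
  qed
  define p where "p z = inverse (q z)" for z
  have zp: "z_over H z = p z" if "z \<in> unit_disc" for z
    using that by (auto simp: z_over_def p_def q_def H0 dH0)
  have p_hol: "p holomorphic_on unit_disc"
    unfolding p_def using q_hol q_nz by (intro holomorphic_intros) auto
  have p0: "p 0 = 1" by (simp add: p_def q0)
  have dp: "deriv p z = - deriv q z * (p z)\<^sup>2" if "z \<in> unit_disc" for z
    unfolding p_def
    by (rule DERIV_imp_deriv)
       (use q_nz[OF that] in \<open>auto intro!: derivative_eq_intros dq[OF that] simp: power2_eq_square field_simps\<close>)
  define u where "u z = (if z = 0 then deriv p 0 else (p z - p 0) / (z - 0))" for z
  have u_hol: "u holomorphic_on unit_disc"
    unfolding u_def using pole_lemma[OF p_hol, of 0] by simp
  have pu: "p z = 1 + z * u z" for z by (simp add: u_def p0)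
  have u0: "u 0 = 0" by (simp add: u_def dp dq0)
  have du: "(u has_field_derivative deriv u z) (at z)" if "z \<in> unit_disc" for z
    using u_hol that holomorphic_derivI[of u unit_disc z] by auto
  have dpu: "deriv p z = u z + z * deriv u z" if "z \<in> unit_disc" for z
  proof (rule DERIV_imp_deriv)
    have "((\<lambda>z. 1 + z * u z) has_field_derivative u z + z * deriv u z) (at z)"
      by (auto intro!: derivative_eq_intros du[OF that])
    then show "(p has_field_derivative u z + z * deriv u z) (at z)"
      using pu by presburger
  qed
  \<comment> \<open>Since \<open>p q = 1\<close> and \<open>p' = - q' p\<^sup>2\<close>, the product
    \<open>p\<^sup>2 H'\<close> equals \<open>p - z p'\<close>; inserting \<open>p = 1 + z u\<close>
    leaves \<open>1 - z\<^sup>2 u'\<close>.\<close>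
  have key: "(z_over H z)\<^sup>2 * deriv H z - 1 = - (z ^ 2 * deriv u z)" if z: "z \<in> unit_disc" for z
  proof -
    have "(p z)\<^sup>2 * deriv H z = (p z * q z) * p z + z * (deriv q z * (p z)\<^sup>2)"
      by (simp add: dH[OF z] power2_eq_square algebra_simps)
    also have "p z * q z = 1" using q_nz[OF z] by (simp add: p_def)
    also have "deriv q z * (p z)\<^sup>2 = - (u z + z * deriv u z)"
      using dp[OF z] dpu[OF z] by simp
    finally show ?thesis
      by (simp add: zp[OF z] pu[of z] power2_eq_square algebra_simps)
  qed
  have du_le: "cmod (deriv u z) \<le> lam" if "z \<in> unit_disc" for z
  proof (rule norm_le_of_norm_power_mult_le[of "deriv u" 2])
    show "deriv u holomorphic_on ball 0 1"
      using u_hol by (rule holomorphic_deriv) simp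
    show "cmod (z\<^sup>2 * deriv u z) \<le> lam" if "z \<in> ball 0 1" for z
      using U[OF that] key[OF that] by simp
  qed (fact that)
  have "cmod (u z - u 0) \<le> lam * cmod (z - 0)"
    by (rule field_differentiable_bound[of unit_disc u "deriv u"])
       (use z du_le in \<open>auto intro!: has_field_derivative_at_within[OF du]\<close>)
  then have "cmod z * cmod (u z) \<le> cmod z * (lam * cmod z)"
    by (intro mult_left_mono) (auto simp: u0)
  also have "\<dots> = lam * (cmod z)\<^sup>2" by (simp add: power2_eq_square)
  also have "\<dots> \<le> lam * 1"
    \<comment> \<open>\<open>lam \<ge> 0\<close> is read off from the defining strict inequality,
      whose left side is a norm.\<close>
    using z le_less_trans[OF norm_ge_zero U[OF z]] by (intro mult_left_mono) (auto simp: power_le_one)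
  finally show ?thesis by (simp add: zp[OF z] pu norm_mult)
qed

text \<open>
  The disc of radius \<open>l\<close> about 1 is seen from 0 under a half-angle of sine \<open>l\<close>, whence
  \<open>cos (2 * arcsin l) = 1 - 2 * l\<^sup>2\<close>.
\<close>
lemma Re_power2_ge:
  assumes "cmod (p - 1) \<le> l"
  shows "Re (p\<^sup>2) \<ge> (1 - 2 * l\<^sup>2) * (cmod p)\<^sup>2"
proof -
  define x y where "x = Re p" and "y = Im p"
  have "(cmod (p - 1))\<^sup>2 \<le> l\<^sup>2"
    using assms by (intro power_mono) auto
  then have 1: "(x - 1)\<^sup>2 + y\<^sup>2 \<le> l\<^sup>2"
    by (simp add: cmod_power2 x_def y_def)
  \<comment> \<open>For \<open>l\<^sup>2 \<le> 1\<close> the claim reduces to the square of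
    \<open>x - (1 - l\<^sup>2)\<close> being nonnegative; \<open>1 - l\<^sup>2\<close> is the
    abscissa of the points where the tangents from 0 touch the circle.\<close>
  have "y\<^sup>2 \<le> l\<^sup>2 * (x\<^sup>2 + y\<^sup>2)"
  proof (cases "l\<^sup>2 \<le> 1")
    case True
    then have "(1 - l\<^sup>2) * y\<^sup>2 \<le> (1 - l\<^sup>2) * (l\<^sup>2 - (x - 1)\<^sup>2)"
      using 1 by (intro mult_left_mono) auto
    moreover have "0 \<le> (x - (1 - l\<^sup>2))\<^sup>2" by simp
    ultimately show ?thesis by (simp add: power2_eq_square algebra_simps)
  next
    case False
    have "y\<^sup>2 \<le> 1 * (x\<^sup>2 + y\<^sup>2)" by simp
    also have "\<dots> \<le> l\<^sup>2 * (x\<^sup>2 + y\<^sup>2)"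
      using False by (intro mult_right_mono) auto
    finally show ?thesis .
  qed
  then have "(1 - 2 * l\<^sup>2) * (x\<^sup>2 + y\<^sup>2) \<le> x\<^sup>2 - y\<^sup>2"
    by (simp add: algebra_simps)
  then show ?thesis
    unfolding cmod_power2 Re_power2 x_def y_def .
qed

text \<open>To be applied with \<open>p = z / H z\<close> and \<open>w = H'\<close>. With
  \<open>p\<^sup>2 w = 1 + g\<close>, multiplying by the conjugate of \<open>p\<^sup>2\<close> turns
  \<open>Re w\<close> into \<open>Re (p\<^sup>2)\<close> plus an error of modulus at most
  \<open>l\<close> times \<open>(cmod p)\<^sup>2\<close>, and \<open>Re_power2_ge\<close> bounds the
  main term.\<close>

lemma Re_minus_norm_ge:
  assumes p: "cmod (p - 1) \<le> l" and w: "cmod (p\<^sup>2 * w - 1) \<le> l" and l: "0 \<le> l" "l < 1"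
    and k: "0 \<le> k" "k * (1 + l) \<le> 1 - l - 2 * l\<^sup>2"
  shows "Re w - k * cmod w \<ge> (1 - l - 2 * l\<^sup>2 - k * (1 + l)) / (1 + l)\<^sup>2"
proof -
  define m where "m = (cmod p)\<^sup>2"
  define g where "g = p\<^sup>2 * w - 1"
  have "p \<noteq> 0" using p l by auto
  then have m: "m > 0" by (simp add: m_def)
  have "cmod p \<le> 1 + l"
    using p norm_triangle_ineq[of "p - 1" 1] by simp
  then have m_le: "m \<le> (1 + l)\<^sup>2"
    by (simp add: m_def power_mono)
  have mw: "m * m * Re w = Re ((1 + g) * cnj (p\<^sup>2))"
  proof -
    have pm: "p * cnj p = of_real m" by (simp only: m_def complex_norm_square)
    have "(1 + g) * cnj (p\<^sup>2) = w * ((p * cnj p) * (p * cnj p))"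
      by (simp add: g_def power2_eq_square mult_ac)
    also have "\<dots> = of_real (m * m) * w" by (simp add: pm)
    finally show ?thesis by simp
  qed
  have "Re ((1 + g) * cnj (p\<^sup>2)) = Re (p\<^sup>2) + Re (g * cnj (p\<^sup>2))"
    by (simp add: power2_eq_square algebra_simps)
  moreover have "Re (p\<^sup>2) \<ge> (1 - 2 * l\<^sup>2) * m"
    unfolding m_def by (rule Re_power2_ge[OF p])
  moreover have "Re (g * cnj (p\<^sup>2)) \<ge> - (l * m)"
  proof -
    have "cmod (g * cnj (p\<^sup>2)) = cmod g * m"
      by (simp add: norm_mult norm_power m_def)
    also have "\<dots> \<le> l * m"
      using w m by (intro mult_right_mono) (auto simp: g_def)
    finally show ?thesis
      using abs_Re_le_cmod[of "g * cnj (p\<^sup>2)"] by linarith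
  qed
  ultimately have "m * (m * Re w) \<ge> m * (1 - l - 2 * l\<^sup>2)"
    using mw by (simp add: algebra_simps)
  then have 1: "m * Re w \<ge> 1 - l - 2 * l\<^sup>2"
    using m by simp
  have "m * cmod w = cmod (1 + g)"
    by (simp add: g_def m_def norm_mult norm_power)
  also have "\<dots> \<le> 1 + l"
    using norm_triangle_ineq[of 1 g] w by (simp add: g_def)
  finally have "k * (m * cmod w) \<le> k * (1 + l)"
    using k by (intro mult_left_mono) auto
  with 1 have "m * (Re w - k * cmod w) \<ge> 1 - l - 2 * l\<^sup>2 - k * (1 + l)"
    by (simp add: algebra_simps)
  then have "Re w - k * cmod w \<ge> (1 - l - 2 * l\<^sup>2 - k * (1 + l)) / m"
    using m by (simp add: field_simps)
  \<comment> \<open>The numerator is nonnegative by the second condition on \<open>k\<close>, so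
    enlarging the denominator \<open>m\<close> to its upper bound is allowed.\<close>
  moreover have "(1 - l - 2 * l\<^sup>2 - k * (1 + l)) / m \<ge> (1 - l - 2 * l\<^sup>2 - k * (1 + l)) / (1 + l)\<^sup>2"
    using m m_le k l by (intro divide_left_mono mult_pos_pos) auto
  ultimately show ?thesis by linarith
qed

section \<open>Strong monotonicity of harmonic mappings\<close>

text \<open>A harmonic Noshiro-Warschawski argument: along the segment with direction
  \<open>v\<close>, the component of the mapping along \<open>v\<close> has derivative
  \<open>Re (H' v cnj v + G' v v)\<close>, which is at least \<open>Re H' - cmod G'\<close> times
  \<open>(cmod v)\<^sup>2\<close>.\<close>

lemma harmonic_strongly_monotone:
  assumes H: "H holomorphic_on S" and G: "G holomorphic_on S"
    and S: "open S" "convex S"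
    and c: "\<And>z. z \<in> S \<Longrightarrow> Re (deriv H z) - cmod (deriv G z) \<ge> c"
    and z: "z \<in> S" and w: "w \<in> S"
  shows "((H z + cnj (G z)) - (H w + cnj (G w))) \<bullet> (z - w) \<ge> c * (cmod (z - w))\<^sup>2"
proof -
  define v where "v = z - w"
  define \<gamma> where "\<gamma> t = w + of_real t * v" for t
  \<comment> \<open>Here \<open>cnj (G z) \<bullet> v = Re (G z * v)\<close>, so the conjugate
    disappears and only holomorphic functions are differentiated.\<close>
  define \<phi> where "\<phi> t = Re (H (\<gamma> t) * cnj v + G (\<gamma> t) * v) - c * (cmod v)\<^sup>2 * t" for t
  have in_S: "\<gamma> t \<in> S" if "0 \<le> t" "t \<le> 1" for t
  proof -
    have "(1 - t) *\<^sub>R w + t *\<^sub>R z \<in> S"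
      using that S z w by (intro convexD) auto
    then show ?thesis by (simp add: \<gamma>_def v_def scaleR_conv_of_real algebra_simps)
  qed
  have "\<phi> 0 \<le> \<phi> 1"
  proof (rule DERIV_nonneg_imp_nondecreasing[of 0 1 \<phi>])
    fix t :: real assume t: "0 \<le> t" "t \<le> 1"
    let ?d = "deriv H (\<gamma> t) * v * cnj v + deriv G (\<gamma> t) * v * v"
    have \<gamma>': "(\<gamma> has_vector_derivative v) (at t)"
      unfolding \<gamma>_def by (auto intro!: derivative_eq_intros)
    have *: "((\<lambda>s. f (\<gamma> s)) has_vector_derivative deriv f (\<gamma> t) * v) (at t)"
      if "f holomorphic_on S" for f
      using field_vector_diff_chain_at[OF \<gamma>' holomorphic_derivI[OF that S(1) in_S[OF t]]]
      by (simp add: o_def mult.commute)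
    have "((\<lambda>t. H (\<gamma> t) * cnj v + G (\<gamma> t) * v) has_vector_derivative ?d) (at t)"
      by (intro has_vector_derivative_add has_vector_derivative_mult_left * H G)
    then have "((\<lambda>t. Re (H (\<gamma> t) * cnj v + G (\<gamma> t) * v)) has_vector_derivative Re ?d) (at t)"
      by (rule bounded_linear.has_vector_derivative[OF bounded_linear_Re])
    then have "((\<lambda>t. Re (H (\<gamma> t) * cnj v + G (\<gamma> t) * v)) has_real_derivative Re ?d) (at t)"
      by (simp only: has_real_derivative_iff_has_vector_derivative)
    moreover have "((\<lambda>t. c * (cmod v)\<^sup>2 * t) has_real_derivative c * (cmod v)\<^sup>2) (at t)"
      by (auto intro!: derivative_eq_intros)
    ultimately have d: "(\<phi> has_real_derivative Re ?d - c * (cmod v)\<^sup>2) (at t)"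
      unfolding \<phi>_def by (rule DERIV_diff)
    have "Re (deriv H (\<gamma> t) * v * cnj v) = Re (deriv H (\<gamma> t) * of_real ((cmod v)\<^sup>2))"
      by (simp only: mult.assoc complex_norm_square)
    then have "Re (deriv H (\<gamma> t) * v * cnj v) = Re (deriv H (\<gamma> t)) * (cmod v)\<^sup>2"
      by simp
    moreover have "Re (deriv G (\<gamma> t) * v * v) \<ge> - (cmod (deriv G (\<gamma> t)) * (cmod v)\<^sup>2)"
      using abs_Re_le_cmod[of "deriv G (\<gamma> t) * v * v"]
      by (simp add: norm_mult power2_eq_square)
    moreover have "(Re (deriv H (\<gamma> t)) - cmod (deriv G (\<gamma> t))) * (cmod v)\<^sup>2 \<ge> c * (cmod v)\<^sup>2"
      using c[OF in_S[OF t]] by (intro mult_right_mono) auto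
    ultimately have "Re ?d - c * (cmod v)\<^sup>2 \<ge> 0"
      by (simp add: algebra_simps)
    with d show "\<exists>y. (\<phi> has_real_derivative y) (at t) \<and> 0 \<le> y" by blast
  qed simp
  then show ?thesis
    by (simp add: \<phi>_def \<gamma>_def v_def inner_complex_def algebra_simps)
qed

section \<open>From monotonicity to disjoint half-lines\<close>

text \<open>
  For a strictly monotone \<open>F\<close> the rays \<open>F a + t a\<close> with \<open>|a| = 1\<close> are disjoint. Together with
  \<open>F\<close> on the disc they are the values of \<open>T z = F (P z) + (z - P z)\<close>, where \<open>P\<close> is the nearest
  point retraction onto the closed disc; \<open>T\<close> is continuous and a bounded perturbation of the
  identity, hence surjective by Brouwer's theorem.
\<close>
lemma close_to_convex_strictly_monotone:
  fixes F :: "complex \<Rightarrow> complex"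
  assumes cont: "continuous_on (cball 0 1) F"
    and mono: "\<And>a b. a \<in> cball 0 1 \<Longrightarrow> b \<in> cball 0 1 \<Longrightarrow> a \<noteq> b \<Longrightarrow> (F a - F b) \<bullet> (a - b) > 0"
  shows "close_to_convex F"
proof -
  define D where "D = - (F ` unit_disc)"
  have dot_le: "a \<bullet> b \<le> 1" if "cmod a \<le> 1" "cmod b \<le> 1" for a b :: complex
    using norm_cauchy_schwarz[of a b] mult_mono[OF that] by simp
  \<comment> \<open>Parameter 0 stands for a point of the closed disc, a positive one for a point
    further out on a ray. One statement thus yields injectivity, rays missing the image, and
    disjoint rays: for \<open>a \<noteq> b\<close> the equation would make the inner product
    nonpositive.\<close>
  have key: "a = b"
    if eq: "F a + of_real s * a = F b + of_real t * b"
      and a: "cmod a \<le> 1" "s = 0 \<or> s > 0 \<and> cmod a = 1"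
      and b: "cmod b \<le> 1" "t = 0 \<or> t > 0 \<and> cmod b = 1" for a b s t
  proof (rule ccontr)
    assume "a \<noteq> b"
    then have pos: "(F a - F b) \<bullet> (a - b) > 0" using mono a b by simp
    have "F a - F b = t *\<^sub>R b - s *\<^sub>R a"
      using eq by (simp add: scaleR_conv_of_real algebra_simps)
    then have "(F a - F b) \<bullet> (a - b) = (t *\<^sub>R b - s *\<^sub>R a) \<bullet> (a - b)"
      by (simp only:)
    also have "\<dots> = - (s * (a \<bullet> a - a \<bullet> b)) - t * (b \<bullet> b - a \<bullet> b)"
      by (simp add: inner_diff inner_commute algebra_simps)
    finally have *: "(F a - F b) \<bullet> (a - b) = - (s * (a \<bullet> a - a \<bullet> b)) - t * (b \<bullet> b - a \<bullet> b)" .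
    have "s * (a \<bullet> a - a \<bullet> b) \<ge> 0" "t * (b \<bullet> b - a \<bullet> b) \<ge> 0"
      using a b dot_le[of a b] by (auto simp: dot_square_norm)
    then show False using pos * by linarith
  qed
  have inj: "inj_on F unit_disc"
    by (rule inj_onI) (use key[of _ 0 _ 0] in auto)
  have rays: "F a + of_real t * a \<in> D" if "cmod a = 1" "t \<ge> 0" for a t
  proof (rule ccontr)
    assume "F a + of_real t * a \<notin> D"
    then obtain b where "cmod b < 1" "F a + of_real t * a = F b" by (auto simp: D_def)
    moreover have "t = 0 \<or> t > 0" using that by linarith
    ultimately have "a = b" using key[of a t b 0] that by simp
    with that \<open>cmod b < 1\<close> show False by simp
  qed
  have surj: "\<exists>a t. cmod a = 1 \<and> t \<ge> 0 \<and> y = F a + of_real t * a" if y: "y \<in> D" for y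
  proof -
    define P where "P z = z /\<^sub>R max 1 (cmod z)" for z
    have P: "P z \<in> cball 0 1" for z by (auto simp: P_def field_simps)
    have contP: "continuous_on A P" for A
      unfolding P_def by (intro continuous_intros) auto
    define T where "T z = F (P z) + (z - P z)" for z
    have contT: "continuous_on A T" for A
      unfolding T_def
      by (intro continuous_intros contP continuous_on_compose2[OF cont contP]) (use P in auto)
    have "compact (F ` cball 0 1)"
      using cont by (intro compact_continuous_image) auto
    then obtain B where B: "\<And>z. z \<in> cball 0 1 \<Longrightarrow> cmod (F z) \<le> B"
      using compact_imp_bounded bounded_iff by (metis imageI)
    \<comment> \<open>Since \<open>z - T z = P z - F (P z)\<close> has norm at most
      \<open>1 + B\<close>, the map sending \<open>z\<close> to \<open>y + (z - T z)\<close> stays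
      in the ball of this radius, as Brouwer's theorem requires.\<close>
    define e where "e = cmod y + B + 1"
    have "cmod (F 0) \<le> B" by (rule B) simp
    then have e: "e > 0" unfolding e_def using norm_ge_zero[of "F 0"] norm_ge_zero[of y] by linarith
    have "\<exists>z\<in>cball 0 e. T z = y"
    proof (rule brouwer_surjective_cball[OF contT e, of y "{y}"])
      fix x z assume "x \<in> {y}"
      have "x + (z - T z) = y + (P z - F (P z))" using \<open>x \<in> {y}\<close> by (simp add: T_def)
      also have "cmod \<dots> \<le> cmod y + (cmod (P z) + cmod (F (P z)))"
        by (meson norm_triangle_ineq norm_triangle_ineq4 add_left_mono order_trans)
      also have "\<dots> \<le> e" using B[OF P[of z]] P[of z] by (simp add: e_def)
      finally show "x + (z - T z) \<in> cball 0 e" by simp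
    qed simp
    then obtain z where z: "T z = y" by blast
    show ?thesis
    proof (cases "cmod z < 1")
      case True
      then have "y = F z" using z by (simp add: T_def P_def)
      then show ?thesis using y True by (auto simp: D_def)
    next
      case False
      then have z1: "cmod z \<ge> 1" by simp
      then have Pz: "P z = z /\<^sub>R cmod z" by (simp add: P_def max_def)
      have nz: "cmod z \<noteq> 0" using z1 by linarith
      then have "cmod z *\<^sub>R P z = z" by (simp add: Pz)
      \<comment> \<open>Outside the open disc, \<open>T z\<close> is the point with parameter
        \<open>cmod z - 1\<close> on the ray from \<open>F (P z)\<close>.\<close>
      then have "z - P z = (cmod z - 1) *\<^sub>R P z" by (simp add: scaleR_left_diff_distrib)
      then have "z - P z = of_real (cmod z - 1) * P z"
        by (simp only: scaleR_conv_of_real)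
      then have "y = F (P z) + of_real (cmod z - 1) * P z" using z by (simp add: T_def)
      moreover have "cmod (P z) = 1" using nz by (simp add: Pz)
      ultimately show ?thesis
        using z1 by (intro exI[of _ "P z"] exI[of _ "cmod z - 1"]) auto
    qed
  qed
  \<comment> \<open>The end point lies in \<open>D\<close> as the value at \<open>t = 0\<close>, and
    by continuity it is a limit of values of \<open>F\<close> on the open disc.\<close>
  have fr: "F a \<in> frontier D" if a: "cmod a = 1" for a
  proof -
    have "F a \<in> D" using rays[OF a, of 0] by simp
    moreover have "F a \<in> closure (- D)"
    proof -
      have "F ` closure unit_disc \<subseteq> closure (F ` unit_disc)"
        using cont by (intro image_closure_subset) (auto intro: subsetD[OF closure_subset])
      then show ?thesis using a by (auto simp: D_def)
    qed
    ultimately show ?thesis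
      by (simp add: frontier_closures subsetD[OF closure_subset])
  qed
  have "filled_by_half_lines D"
    unfolding filled_by_half_lines_def
  proof (intro exI[of _ "(\<lambda>a. half_line (F a) a) ` sphere 0 1"] conjI ballI)
    fix L assume "L \<in> (\<lambda>a. half_line (F a) a) ` sphere 0 1"
    then obtain a where a: "cmod a = 1" "L = half_line (F a) a" by auto
    then show "\<exists>a u. a \<in> frontier D \<and> u \<noteq> 0 \<and> L = half_line a u"
      using fr by (intro exI[of _ "F a"] exI[of _ a]) auto
    show "L \<subseteq> D" using a rays by (auto simp: half_line_def)
  next
    show "pairwise disjnt ((\<lambda>a. half_line (F a) a) ` sphere 0 1)"
    proof (clarsimp simp: pairwise_def)
      fix a b assume a: "cmod a = 1" and b: "cmod b = 1"
        and ne: "half_line (F a) a \<noteq> half_line (F b) b"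
      show "disjnt (half_line (F a) a) (half_line (F b) b)"
      proof (rule ccontr)
        assume "\<not> ?thesis"
        then obtain s t where "s \<ge> 0" "t \<ge> 0" "F a + of_real s * a = F b + of_real t * b"
          by (auto simp: disjnt_def half_line_def)
        then have "a = b" using key[of a s b t] a b by force
        with ne show False by simp
      qed
    qed
    show "\<Union> ((\<lambda>a. half_line (F a) a) ` sphere 0 1) = D"
    proof (intro equalityI subsetI)
      fix y assume "y \<in> \<Union> ((\<lambda>a. half_line (F a) a) ` sphere 0 1)"
      then show "y \<in> D" using rays by (auto simp: half_line_def)
    next
      fix y assume "y \<in> D"
      then obtain a t where "cmod a = 1" "t \<ge> 0" "y = F a + of_real t * a"
        using surj by blast
      then show "y \<in> \<Union> ((\<lambda>a. half_line (F a) a) ` sphere 0 1)"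
        by (intro UnionI[of "half_line (F a) a"]) (auto simp: half_line_def)
    qed
  qed
  with inj show ?thesis by (simp add: close_to_convex_def D_def)
qed

lemma close_to_convex_cong:
  assumes "\<And>z. z \<in> unit_disc \<Longrightarrow> F z = F' z"
  shows "close_to_convex F \<longleftrightarrow> close_to_convex F'"
proof -
  have "F ` unit_disc = F' ` unit_disc" using assms by auto
  moreover have "inj_on F unit_disc \<longleftrightarrow> inj_on F' unit_disc"
    using assms by (rule inj_on_cong)
  ultimately show ?thesis by (simp add: close_to_convex_def)
qed

text \<open>The Lipschitz bound extends \<open>F\<close> to the closed disc. A strict inequality
  could degenerate at the boundary, but the quadratic lower bound survives the limit and is still
  positive for distinct points.\<close>

lemma close_to_convex_lipschitz_strongly_monotone:
  fixes F :: "complex \<Rightarrow> complex"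
  assumes lip: "C-lipschitz_on unit_disc F" and c: "c > 0"
    and mono: "\<And>z w. z \<in> unit_disc \<Longrightarrow> w \<in> unit_disc \<Longrightarrow>
      (F z - F w) \<bullet> (z - w) \<ge> c * (cmod (z - w))\<^sup>2"
  shows "close_to_convex F"
proof -
  obtain E where lipE: "C-lipschitz_on (cball 0 1) E" and E: "\<And>z. z \<in> unit_disc \<Longrightarrow> E z = F z"
    using lipschitz_extend_closure[OF lip] by auto
  have cont: "continuous_on (cball 0 1) E"
    using lipE by (rule lipschitz_on_continuous_on)
  have ge: "(E a - E b) \<bullet> (a - b) - c * (cmod (a - b))\<^sup>2 \<ge> 0" if "a \<in> cball 0 1" "b \<in> cball 0 1" for a b
  proof -
    \<comment> \<open>Both points move to the boundary at once: the inequality is a closed condition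
      on the product of two discs.\<close>
    let ?f = "\<lambda>x. (E (fst x) - E (snd x)) \<bullet> (fst x - snd x) - c * (cmod (fst x - snd x))\<^sup>2"
    have cl: "closure (unit_disc \<times> unit_disc) = cball 0 1 \<times> (cball 0 1 :: complex set)"
      by (simp add: closure_Times)
    have *: "continuous_on (cball 0 1 \<times> cball 0 1) (\<lambda>x. E (fst x))"
      "continuous_on (cball 0 1 \<times> cball 0 1) (\<lambda>x. E (snd x))"
      by (rule continuous_on_compose2[OF cont]; auto intro!: continuous_intros)+
    have "continuous_on (cball 0 1 \<times> cball 0 1) ?f"
      by (intro continuous_intros *)
    then have "?f (a, b) \<ge> 0"
    proof (rule continuous_ge_on_closure[of "unit_disc \<times> unit_disc" ?f "(a, b)" 0, unfolded cl])
      show "(a, b) \<in> cball 0 1 \<times> cball 0 1" using that by blast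
      show "?f x \<ge> 0" if "x \<in> unit_disc \<times> unit_disc" for x
        using mono[of "fst x" "snd x"] that E[of "fst x"] E[of "snd x"] by (simp add: mem_Times_iff)
    qed
    then show ?thesis by simp
  qed
  have "close_to_convex E"
  proof (rule close_to_convex_strictly_monotone[OF cont])
    fix a b :: complex assume ab: "a \<in> cball 0 1" "b \<in> cball 0 1" "a \<noteq> b"
    then have "0 < c * (cmod (a - b))\<^sup>2" using c by simp
    with ge[OF ab(1,2)] show "(E a - E b) \<bullet> (a - b) > 0" by linarith
  qed
  then show ?thesis using close_to_convex_cong E by blast
qed

section \<open>Constants for \<open>lam \<le> sqrt 2 - 1\<close>, sense-preservation and
  close-to-convexity\<close>

theorem theorem5:
  fixes lam :: real and F H G :: "complex \<Rightarrow> complex"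
  assumes "0 < lam" and "lam \<le> sqrt 2 - 1"
    and "H \<in> class_U2 lam"
    and "harmonic_mapping F H G" and "G 0 = 0"
    and "dilatation H G 0 = 0"
    and "\<forall>z\<in>unit_disc. cmod (dilatation H G z) \<le> (1 - 2 * lam - lam\<^sup>2) / (1 + lam)\<^sup>2"
  shows "sense_preserving H G \<and> close_to_convex F"
proof -
  define k where "k = (1 - 2 * lam - lam\<^sup>2) / (1 + lam)\<^sup>2"
  define c where "c = (1 - lam - 2 * lam\<^sup>2 - k * (1 + lam)) / (1 + lam)\<^sup>2"
  have hol: "H holomorphic_on unit_disc" "G holomorphic_on unit_disc"
    and F: "\<And>z. z \<in> unit_disc \<Longrightarrow> F z = H z + cnj (G z)"
    using assms(4) by (auto simp: harmonic_mapping_def)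
  have "(1 + lam)\<^sup>2 \<le> (sqrt 2)\<^sup>2"
    using assms(1,2) by (intro power_mono) auto
  then have lam2: "2 * lam + lam\<^sup>2 \<le> 1" by (simp add: power2_eq_square algebra_simps)
  have lam1: "lam < 1/2" using lam2 assms(1) zero_less_power[OF assms(1), of 2] by linarith
  have k0: "0 \<le> k" using lam2 by (simp add: k_def)
  have k1: "k \<le> 1" using assms(1) by (simp add: k_def divide_le_eq power2_eq_square algebra_simps)
  have "k * (1 + lam)\<^sup>2 = 1 - 2 * lam - lam\<^sup>2"
    using assms(1) by (simp add: k_def)
  \<comment> \<open>The factor \<open>1 + lam\<close> clears the denominator of \<open>k\<close>;
    the positive remainder is the strict margin that makes \<open>c > 0\<close>.\<close>
  then have "(1 - lam - 2 * lam\<^sup>2) * (1 + lam) - k * (1 + lam)\<^sup>2 = 2 * lam * (1 - lam - lam\<^sup>2)"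
    by (simp add: power2_eq_square algebra_simps)
  moreover have "2 * lam * (1 - lam - lam\<^sup>2) > 0"
    using lam2 assms(1) by (intro mult_pos_pos) auto
  ultimately have "(1 - lam - 2 * lam\<^sup>2 - k * (1 + lam)) * (1 + lam) > 0"
    by (simp add: power2_eq_square algebra_simps)
  then have k: "k * (1 + lam) < 1 - lam - 2 * lam\<^sup>2"
    using assms(1) by (simp add: zero_less_mult_iff)
  then have c: "c > 0" using assms(1) by (simp add: c_def)
  have pU: "cmod (z_over H z - 1) \<le> lam" "cmod ((z_over H z)\<^sup>2 * deriv H z - 1) \<le> lam"
    if "z \<in> unit_disc" for z
    using class_U2_z_over_bound[OF assms(3) that] assms(3) that
    by (auto simp: class_U2_def class_U_def less_imp_le)
  have Re_H: "Re (deriv H z) - k * cmod (deriv H z) \<ge> c" if "z \<in> unit_disc" for z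
    unfolding c_def using assms(1) lam1 k0 k
    by (intro Re_minus_norm_ge[OF pU[OF that]]) auto
  have G_le: "cmod (deriv G z) \<le> k * cmod (deriv H z)" if "z \<in> unit_disc" for z
  proof -
    \<comment> \<open>\<open>deriv H z \<noteq> 0\<close> has to come first: at a zero of it,
      division by 0 would give dilatation 0 and no control of \<open>deriv G z\<close>.\<close>
    have "0 \<le> k * cmod (deriv H z)" using k0 by simp
    then have "Re (deriv H z) > 0" using Re_H[OF that] c by linarith
    then have "deriv H z \<noteq> 0" by auto
    moreover have "cmod (dilatation H G z) \<le> k"
      using assms(7) that by (simp add: k_def)
    ultimately show ?thesis
      by (simp add: dilatation_def norm_divide divide_le_eq)
  qed
  have Re_HG: "Re (deriv H z) - cmod (deriv G z) \<ge> c" if "z \<in> unit_disc" for z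
    using Re_H[OF that] G_le[OF that] by linarith
  have sp: "sense_preserving H G"
    unfolding sense_preserving_def jacobian_def
  proof
    fix z assume "z \<in> unit_disc"
    then have "cmod (deriv G z) < cmod (deriv H z)"
      using Re_HG[of z] c complex_Re_le_cmod[of "deriv H z"] by linarith
    then show "(cmod (deriv H z))\<^sup>2 - (cmod (deriv G z))\<^sup>2 > 0"
      using power_strict_mono[of "cmod (deriv G z)" "cmod (deriv H z)" 2] by simp
  qed
  \<comment> \<open>The bound comes from \<open>cmod (p\<^sup>2 H') \<le> 1 + lam\<close> and
    \<open>cmod p \<ge> 1 - lam\<close> with \<open>p = z_over H z\<close>. As
    \<open>k \<le> 1\<close>, it also serves for \<open>G\<close>, whence the Lipschitz constant
    \<open>2 * B\<close>.\<close>
  define B where "B = (1 + lam) / (1 - lam)\<^sup>2"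
  have B0: "B \<ge> 0" using assms(1) by (simp add: B_def)
  have H_le: "cmod (deriv H z) \<le> B" if "z \<in> unit_disc" for z
  proof -
    have "(cmod (z_over H z))\<^sup>2 * cmod (deriv H z) \<le> 1 + lam"
      using pU(2)[OF that] norm_triangle_ineq[of "(z_over H z)\<^sup>2 * deriv H z - 1" 1]
      by (simp add: norm_mult norm_power)
    moreover have "1 - lam \<le> cmod (z_over H z)"
      using pU(1)[OF that] norm_triangle_ineq3[of 1 "z_over H z"] by (simp add: norm_minus_commute)
    then have "(1 - lam)\<^sup>2 * cmod (deriv H z) \<le> (cmod (z_over H z))\<^sup>2 * cmod (deriv H z)"
      using lam1 by (intro mult_right_mono power_mono) auto
    ultimately show ?thesis using lam1 by (simp add: B_def field_simps)
  qed
  have lip: "(2 * B)-lipschitz_on unit_disc F"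
  proof (rule lipschitz_onI)
    fix z w :: complex assume zw: "z \<in> unit_disc" "w \<in> unit_disc"
    have lip': "cmod (f z - f w) \<le> B * cmod (z - w)"
      if f: "f holomorphic_on unit_disc" "\<And>z. z \<in> unit_disc \<Longrightarrow> cmod (deriv f z) \<le> B" for f
    proof (rule field_differentiable_bound[of unit_disc f "deriv f"])
      show "(f has_field_derivative deriv f z) (at z within unit_disc)" if "z \<in> unit_disc" for z
        using f(1) _ that by (rule holomorphic_derivI) simp
    qed (use f zw in auto)
    have G_B: "cmod (deriv G z) \<le> B" if "z \<in> unit_disc" for z
      using G_le[OF that] H_le[OF that] mult_right_mono[OF k1 norm_ge_zero[of "deriv H z"]] by linarith
    have "F z - F w = (H z - H w) + cnj (G z - G w)" using F zw by simp
    also have "cmod \<dots> \<le> cmod (H z - H w) + cmod (G z - G w)"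
      by (metis norm_triangle_ineq complex_mod_cnj)
    also have "\<dots> \<le> 2 * B * cmod (z - w)"
      using lip'[OF hol(1) H_le] lip'[OF hol(2) G_B] by simp
    finally show "dist (F z) (F w) \<le> 2 * B * dist z w" by (simp add: dist_norm)
  qed (use B0 in simp)
  have "close_to_convex F"
  proof (rule close_to_convex_lipschitz_strongly_monotone[OF lip c])
    fix z w :: complex assume "z \<in> unit_disc" "w \<in> unit_disc"
    then show "c * (cmod (z - w))\<^sup>2 \<le> (F z - F w) \<bullet> (z - w)"
      using harmonic_strongly_monotone[OF hol _ _ Re_HG, of z w] by (simp add: F)
  qed
  with sp show ?thesis by blast
qed

end
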